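(* Let $(M,\rho)$ be a perfect Polish metric space, let $X=\prod_{-\infty}^{+\infty}M$ with the metric $d$ given in the context, and let $T:X\to X$ be the full-shift. Then each of the sets $\mathfrak{R}^-=\{x\in X\mid\overline{R}(x)=\infty\}$ and $\mathfrak{R}_-=\{x\in X\mid\underline{R}(x)=0\}$ is a dense $G_\delta$ subset of $X$. Moreover, for each $T$-invariant Borel probability measure $\mu$ on $X$ such that $\operatorname{supp}(\mu)=X$, $\overline{R}(x)=+\infty$ for $\mu$-a.e. $x$, and $\underline{R}(x)=0$ for $\mu$-a.e. $x$, one has $\mu(\mathfrak{R}^-\cap\mathfrak{R}_-)=1$.
   Context: A Polish metric space is a complete separable metric space; it is perfect if it has no isolated points. $X=\prod_{-\infty}^{+\infty}M$ is the set of bilateral sequences $x=(x_n)_{n\in\mathbb{Z}}$ in $M$, with $d(x,y)=\sum_{n\in\mathbb{Z}}\frac{1}{2^{|n|}}\frac{\rho(x_n,y_n)}{1+\rho(x_n,y_n)}$, and $(Tx)_i=x_{i-1}$ for all $i\in\mathbb{Z}$. Recurrence rates. $\tau_r(x)=\inf\{k\in\mathbb{N}\mid T^kx\in\overline{B}(x,r)\}$ with $\mathbb{N}=\{1,2,\dots\}$, $\overline{B}(x,r)$ the closed ball, $\inf\emptyset=\infty$, $\log\infty=\infty$; $\underline{R}(x)=\liminf_{r\to0}\frac{\log\tau_r(x)}{-\log r}$ and $\overline{R}(x)=\limsup_{r\to0}\frac{\log\tau_r(x)}{-\log r}$. *)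

theory Defs
  imports "HOL-Probability.Probability"
begin

definition full_shift :: "(int \<Rightarrow> 'a) \<Rightarrow> (int \<Rightarrow> 'a)" where
  "full_shift x = (\<lambda>i. x (i - 1))"

(* Not the metric_space instance of int => 'a, which is a different metric
   (depending on an enumeration of int) for the same topology. *)
definition shift_dist :: "(int \<Rightarrow> 'a::metric_space) \<Rightarrow> (int \<Rightarrow> 'a) \<Rightarrow> real" where
  "shift_dist x y =
     (\<Sum>\<^sub>\<infinity>n\<in>UNIV. 1 / 2 ^ nat \<bar>n\<bar> * (dist (x n) (y n) / (1 + dist (x n) (y n))))"

lemma summable_weights: "(\<lambda>n::int. 1 / 2 ^ nat \<bar>n\<bar> :: real) summable_on UNIV"
proof -
  have g: "(\<lambda>k::nat. (1/2) ^ k :: real) summable_on UNIV"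
    by (rule norm_summable_imp_summable_on) (simp add: summable_geometric_iff)
  have g2: "(\<lambda>k::nat. (1/2) * (1/2) ^ k :: real) summable_on UNIV"
    by (rule summable_on_cmult_right) (rule g)
  have 1: "(\<lambda>n::int. 1 / 2 ^ nat \<bar>n\<bar> :: real) summable_on range int"
    by (subst summable_on_reindex) (use g in \<open>auto simp: o_def power_one_over\<close>)
  have 2: "(\<lambda>n::int. 1 / 2 ^ nat \<bar>n\<bar> :: real) summable_on range (\<lambda>k. - int k - 1)"
  proof (subst summable_on_reindex)
    show "inj (\<lambda>k. - int k - 1)" by (auto simp: inj_def)
    have "nat \<bar>- int k - 1\<bar> = Suc k" for k by linarith
    then show "(\<lambda>n::int. 1 / 2 ^ nat \<bar>n\<bar> :: real) \<circ> (\<lambda>k. - int k - 1) summable_on UNIV"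
      using g2 by (simp add: o_def power_one_over)
  qed
  have "n \<in> range int \<union> range (\<lambda>k. - int k - 1)" for n
  proof (cases "n \<ge> 0")
    case True
    then have "n = int (nat n)" by simp
    then show ?thesis by blast
  next
    case False
    then have "n = - int (nat (- n - 1)) - 1" by simp
    then show ?thesis by blast
  qed
  then have "(UNIV::int set) = range int \<union> range (\<lambda>k. - int k - 1)" by blast
  then show ?thesis
    using summable_on_union[OF 1 2] by simp
qed

lemma ratio_bounds:
  fixes a :: real assumes "a \<ge> 0"
  shows "0 \<le> a / (1 + a)" "a / (1 + a) \<le> 1" "a / (1 + a) \<le> a"
  using assms by (auto simp: divide_simps mult_left_mono algebra_simps)

lemma summable_shift_dist:
  fixes x y :: "int \<Rightarrow> 'a::metric_space"
  shows "(\<lambda>n. 1 / 2 ^ nat \<bar>n\<bar> * (dist (x n) (y n) / (1 + dist (x n) (y n)))) summable_on UNIV"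
  by (rule summable_on_comparison_test[OF summable_weights])
     (rule mult_left_le, rule ratio_bounds(2), simp, simp, simp)

lemma term_le_shift_dist:
  fixes x y :: "int \<Rightarrow> 'a::metric_space"
  shows "1 / 2 ^ nat \<bar>n\<bar> * (dist (x n) (y n) / (1 + dist (x n) (y n))) \<le> shift_dist x y"
  using finite_sum_le_infsum[OF summable_shift_dist, of "{n}" x y]
  by (simp add: shift_dist_def)

global_interpretation fullshift: Metric_space UNIV
  "shift_dist :: (int \<Rightarrow> 'a::metric_space) \<Rightarrow> (int \<Rightarrow> 'a) \<Rightarrow> real"
proof
  fix x y z :: "int \<Rightarrow> 'a"
  show nonneg: "0 \<le> shift_dist x y"
    unfolding shift_dist_def by (rule infsum_nonneg) simp
  show "shift_dist x y = shift_dist y x"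
    by (simp add: shift_dist_def dist_commute)
  show "shift_dist x y = 0 \<longleftrightarrow> x = y"
  proof
    assume "shift_dist x y = 0"
    then have "1 / 2 ^ nat \<bar>n\<bar> * (dist (x n) (y n) / (1 + dist (x n) (y n))) \<le> 0" for n
      using term_le_shift_dist[of n x y] by simp
    then have "dist (x n) (y n) / (1 + dist (x n) (y n)) \<le> 0" for n
      by (metis mult_pos_pos not_le zero_less_divide_1_iff zero_less_numeral zero_less_power)
    then have "dist (x n) (y n) = 0" for n
      using zero_le_dist[of "x n" "y n"]
      by (smt (verit, best) divide_pos_pos)
    then show "x = y" by (auto simp: fun_eq_iff)
  qed (simp add: shift_dist_def)
  have tri: "c / (1 + c) \<le> a / (1 + a) + b / (1 + b)"
    if "a \<ge> 0" "b \<ge> 0" "c \<ge> 0" "c \<le> a + b" for a b c :: real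
  proof -
    have "c / (1 + c) \<le> (a + b) / (1 + (a + b))"
      using that by (simp add: frac_le_eq divide_simps algebra_simps)
    also have "\<dots> = a / (1 + (a + b)) + b / (1 + (a + b))"
      by (simp add: add_divide_distrib)
    also have "\<dots> \<le> a / (1 + a) + b / (1 + b)"
      using that by (intro add_mono frac_le) auto
    finally show ?thesis .
  qed
  show "shift_dist x z \<le> shift_dist x y + shift_dist y z"
    unfolding shift_dist_def
    by (subst infsum_add[OF summable_shift_dist summable_shift_dist, symmetric],
        rule infsum_mono[OF summable_shift_dist summable_on_add[OF summable_shift_dist summable_shift_dist]],
        unfold distrib_left[symmetric],
        rule mult_left_mono[OF tri]) (auto intro: dist_triangle)
qed

(* In particular the type-class notions on int => 'a (open, borel, ...) are those of shift_dist. *)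
lemma mtopology_shift_dist:
  "fullshift.mtopology = (euclidean :: (int \<Rightarrow> 'a::metric_space) topology)"
proof (rule topology_eq[THEN iffD2], intro allI iffI)
  fix U :: "(int \<Rightarrow> 'a) set"
  assume U: "openin fullshift.mtopology U"
  show "openin euclidean U"
    unfolding open_openin[symmetric]
  proof (subst open_subopen, intro ballI)
    fix x assume "x \<in> U"
    then obtain e where e: "e > 0" "fullshift.mball x e \<subseteq> U"
      using U by (auto simp: fullshift.openin_mtopology)
    define w where "w = (\<lambda>n::int. 1 / 2 ^ nat \<bar>n\<bar> :: real)"
    define W where "W = infsum w UNIV"
    have w: "w summable_on UNIV" "\<And>n. w n \<ge> 0"
      using summable_weights by (auto simp: w_def)
    have "(sum w \<longlongrightarrow> W) (finite_subsets_at_top UNIV)"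
      unfolding W_def by (rule infsum_tendsto[OF w(1)])
    then have "\<forall>\<^sub>F F in finite_subsets_at_top UNIV. dist (sum w F) W < e / 2"
      by (rule tendstoD) (use e in simp)
    then obtain F where F: "finite F" "dist (sum w F) W < e / 2"
      by (auto simp: eventually_finite_subsets_at_top)
    have W: "W = sum w F + infsum w (- F)"
      unfolding W_def
      using infsum_Un_disjoint[of w F "- F"] F(1) w(1)
      by (simp add: summable_on_subset_banach[OF w(1)])
    then have tail: "infsum w (- F) < e / 2"
      using F(2) by (auto simp: dist_real_def)
    define c where "c = e / (2 * (1 + sum w F))"
    have sF: "sum w F \<ge> 0" by (simp add: sum_nonneg w)
    then have c: "c > 0" using e by (simp add: c_def)
    define V where "V = {y. \<forall>i\<in>F. y i \<in> ball (x i) c}"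
    have V: "V = (\<Pi>\<^sub>E i\<in>UNIV. if i \<in> F then ball (x i) c else UNIV)"
      by (auto simp: V_def PiE_iff split: if_splits)
    have "open V"
      unfolding V by (rule open_PiE) (use F(1) in \<open>auto intro: finite_subset[OF _ F(1)]\<close>)
    moreover have "x \<in> V" using c by (simp add: V_def)
    moreover have "V \<subseteq> U"
    proof
      fix y assume y: "y \<in> V"
      let ?f = "\<lambda>n. w n * (dist (x n) (y n) / (1 + dist (x n) (y n)))"
      have f: "?f summable_on A" for A
        using summable_shift_dist[of x y] unfolding w_def
        by (rule summable_on_subset_banach) simp
      have "shift_dist x y = sum ?f F + infsum ?f (- F)"
        using infsum_Un_disjoint[of ?f F "- F"] F(1) f by (simp add: shift_dist_def w_def)
      also have "sum ?f F \<le> (\<Sum>n\<in>F. w n * c)"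
      proof (intro sum_mono mult_left_mono w)
        fix n assume "n \<in> F"
        then have "dist (x n) (y n) < c" using y by (simp add: V_def)
        then show "dist (x n) (y n) / (1 + dist (x n) (y n)) \<le> c"
          using ratio_bounds(3)[of "dist (x n) (y n)"] by simp
      qed
      also have "\<dots> = sum w F * c" by (simp add: sum_distrib_right)
      also have "\<dots> < e / 2" using sF e by (simp add: c_def divide_simps)
      also have "infsum ?f (- F) \<le> infsum w (- F)"
        by (rule infsum_mono[OF f summable_on_subset_banach[OF w(1)]])
           (simp, rule mult_left_le[OF ratio_bounds(2) w(2)], simp)
      also note tail
      finally show "y \<in> U" using e(2) by (auto simp: fullshift.in_mball)
    qed
    ultimately show "\<exists>T. open T \<and> x \<in> T \<and> T \<subseteq> U" by blast
  qed
next
  fix U :: "(int \<Rightarrow> 'a) set"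
  assume "openin euclidean U"
  then have U: "openin (product_topology (\<lambda>i. euclidean) UNIV) U"
    by (simp add: open_fun_def open_openin[symmetric])
  show "openin fullshift.mtopology U"
    unfolding fullshift.openin_mtopology
  proof (intro conjI allI impI)
    fix x assume "x \<in> U"
    then obtain X where X: "x \<in> Pi\<^sub>E UNIV X" "\<And>i. open (X i)" "finite {i. X i \<noteq> UNIV}"
        "Pi\<^sub>E UNIV X \<subseteq> U"
      using product_topology_open_contains_basis[OF U, of x] by (simp, blast)
    have "\<exists>e>0. ball (x i) e \<subseteq> X i" for i
      using X(1,2) open_contains_ball by (metis PiE_mem UNIV_I)
    then obtain e where e: "\<And>i. e i > 0" "\<And>i. ball (x i) (e i) \<subseteq> X i" by metis
    define I where "I = {i. X i \<noteq> UNIV}"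
    define h where "h = (\<lambda>i. 1 / 2 ^ nat \<bar>i\<bar> * (e i / (1 + e i)))"
    define r where "r = Min (insert 1 (h ` I))"
    have hpos: "h i > 0" for i using e(1)[of i] by (simp add: h_def)
    have fin: "finite I" using X(3) by (simp add: I_def)
    have r: "r > 0" unfolding r_def using fin hpos by (subst Min_gr_iff) auto
    have "fullshift.mball x r \<subseteq> U"
    proof
      fix y assume "y \<in> fullshift.mball x r"
      then have y: "shift_dist x y < r" by (simp add: fullshift.in_mball)
      have "y i \<in> X i" for i
      proof (cases "i \<in> I")
        case True
        let ?a = "dist (x i) (y i)"
        have "1 / 2 ^ nat \<bar>i\<bar> * (?a / (1 + ?a)) < r"
          using y term_le_shift_dist[of i x y] by simp
        also have "r \<le> h i" unfolding r_def using True fin by (intro Min_le) auto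
        finally have *: "1 / 2 ^ nat \<bar>i\<bar> * (?a / (1 + ?a)) < h i" .
        have "?a < e i"
        proof (rule ccontr)
          assume "\<not> ?a < e i"
          then have "e i / (1 + e i) \<le> ?a / (1 + ?a)"
            using e(1)[of i] by (simp add: frac_le_eq divide_simps algebra_simps add_pos_nonneg)
          then have "h i \<le> 1 / 2 ^ nat \<bar>i\<bar> * (?a / (1 + ?a))"
            unfolding h_def by (rule mult_left_mono) simp
          with * show False by simp
        qed
        then show ?thesis using e(2)[of i] by auto
      qed (auto simp: I_def)
      then show "y \<in> U" using X(4) by (auto simp: PiE_iff)
    qed
    then show "\<exists>r>0. fullshift.mball x r \<subseteq> U" using r by blast
  qed simp
qed

(* The infimum of the empty set in enat is infinity. *)
definition return_time :: "(int \<Rightarrow> 'a::metric_space) \<Rightarrow> real \<Rightarrow> enat" where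
  "return_time x r = Inf {enat k |k. k \<ge> 1 \<and> (full_shift ^^ k) x \<in> fullshift.mcball x r}"

definition log_enat :: "enat \<Rightarrow> ereal" where
  "log_enat k = (case k of enat n \<Rightarrow> ereal (ln (real n)) | \<infinity> \<Rightarrow> \<infinity>)"

definition lower_rate :: "(int \<Rightarrow> 'a::metric_space) \<Rightarrow> ereal" where
  "lower_rate x = Liminf (at_right 0) (\<lambda>r::real. log_enat (return_time x r) / ereal (- ln r))"

definition upper_rate :: "(int \<Rightarrow> 'a::metric_space) \<Rightarrow> ereal" where
  "upper_rate x = Limsup (at_right 0) (\<lambda>r::real. log_enat (return_time x r) / ereal (- ln r))"

definition msupport :: "'a::topological_space measure \<Rightarrow> 'a set" where
  "msupport \<mu> = {x. \<forall>U. open U \<and> x \<in> U \<longrightarrow> emeasure \<mu> U > 0}"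

end

theory Submission
  imports Defs "HOL-Real_Asymp.Real_Asymp"
begin

text \<open>
  Both rates are limits of \<open>log \<tau>\<^sub>r(x) / - log r\<close>, and bounding this quotient by \<open>c\<close> amounts to a
  return \<open>d(x, T\<^sup>k x) \<le> r\<close> at some time \<open>k \<le> r\<^sup>-\<^sup>c\<close>, a condition on finitely many \<open>k\<close>.  This
  writes the two sets as countable intersections of open sets.  No appeal to Baire's theorem is
  needed for density: periodic points are dense and have lower rate 0, and points one of whose
  coordinates stays away from all preceding coordinates are dense, since \<open>M\<close> is infinite, and
  have infinite return times, hence upper rate infinity.
\<close>

section \<open>Return times and bounds on the rate at a fixed radius\<close>

lemma funpow_full_shift: "(full_shift ^^ k) x = (\<lambda>i. x (i - int k))"
  by (induction k) (auto simp: full_shift_def fun_eq_iff algebra_simps)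

text \<open>The facts about it are stated for \<open>0 < r\<close> and \<open>r < 1\<close>, where
  the denominator \<open>- ln r\<close> is positive.\<close>

definition rate :: "(int \<Rightarrow> 'a::metric_space) \<Rightarrow> real \<Rightarrow> ereal" where
  "rate x r = log_enat (return_time x r) / ereal (- ln r)"

lemma return_time_le:
  assumes "k \<ge> 1" "shift_dist x ((full_shift ^^ k) x) \<le> r"
  shows "return_time x r \<le> enat k"
  unfolding return_time_def using assms by (intro Inf_lower) auto

text \<open>The empty set has infimum \<open>\<infinity>\<close>, so a finite value comes from a
  nonempty set, and well-ordering makes the infimum a minimum.\<close>

lemma return_time_attained:
  assumes "return_time x r = enat k"
  shows "k \<ge> 1" "shift_dist x ((full_shift ^^ k) x) \<le> r"
proof -
  define A where "A = {enat k |k. k \<ge> 1 \<and> (full_shift ^^ k) x \<in> fullshift.mcball x r}"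
  have Inf: "Inf A = enat k"
    using assms by (simp add: return_time_def A_def)
  then have "A \<noteq> {}"
    by (auto simp: Inf_enat_def)
  then have "Inf A \<in> A"
    by (simp add: Inf_enat_def) (metis (mono_tags, lifting) LeastI_ex ex_in_conv)
  then show "k \<ge> 1" "shift_dist x ((full_shift ^^ k) x) \<le> r"
    unfolding Inf by (auto simp: A_def)
qed

lemma rate_infinite: "0 < r \<Longrightarrow> r < 1 \<Longrightarrow> return_time x r = \<infinity> \<Longrightarrow> rate x r = \<infinity>"
  by (simp add: rate_def log_enat_def)

lemma rate_finite: "0 < r \<Longrightarrow> r < 1 \<Longrightarrow> return_time x r = enat k \<Longrightarrow> rate x r = ereal (ln k / - ln r)"
  by (simp add: rate_def log_enat_def)

text \<open>Multiply by \<open>- ln r > 0\<close> and exponentiate: the logarithm of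
  \<open>r powr - c\<close> is \<open>c * - ln r\<close>.\<close>

lemma ln_quotient_iff:
  assumes "0 < r" "r < 1" "k \<ge> (1::nat)"
  shows "ln k / - ln r < c \<longleftrightarrow> real k < r powr - c"
    and "ln k / - ln r \<le> c \<longleftrightarrow> real k \<le> r powr - c"
proof -
  have "- ln r > 0" "r powr - c > 0" "real k > 0" using assms by auto
  moreover have "ln (r powr - c) = c * - ln r" using assms by (simp add: ln_powr)
  ultimately show "ln k / - ln r < c \<longleftrightarrow> real k < r powr - c"
      "ln k / - ln r \<le> c \<longleftrightarrow> real k \<le> r powr - c"
    by (metis pos_divide_less_eq ln_less_cancel_iff, metis pos_divide_le_eq ln_le_cancel_iff)
qed

text \<open>Eliminates the infimum and the logarithm. A finite return time is itself a witness
  \<open>k\<close> and bounds every other witness from below; if the return time is infinite, both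
  sides fail.\<close>

lemma rate_iff:
  assumes "0 < r" "r < 1"
  shows "rate x r < ereal c \<longleftrightarrow>
      (\<exists>k\<ge>1. shift_dist x ((full_shift ^^ k) x) \<le> r \<and> real k < r powr - c)" (is ?less)
    and "rate x r \<le> ereal c \<longleftrightarrow>
      (\<exists>k\<ge>1. shift_dist x ((full_shift ^^ k) x) \<le> r \<and> real k \<le> r powr - c)" (is ?le)
proof -
  have "?less \<and> ?le"
  proof (cases "return_time x r")
    case (enat m)
    note m = return_time_attained[OF enat]
    have *: "rate x r < ereal c \<longleftrightarrow> real m < r powr - c" "rate x r \<le> ereal c \<longleftrightarrow> real m \<le> r powr - c"
      using rate_finite[OF assms enat] ln_quotient_iff[OF assms m(1)] by simp_all
    have "real m \<le> real k" if "k \<ge> 1" "shift_dist x ((full_shift ^^ k) x) \<le> r" for k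
      using return_time_le[OF that] enat by simp
    then show ?thesis
      unfolding * using m by (meson le_less_trans order_trans)
  next
    case infinity
    then have "\<not> shift_dist x ((full_shift ^^ k) x) \<le> r" if "k \<ge> 1" for k
      using return_time_le[OF that, of x r] by auto
    then show ?thesis using rate_infinite[OF assms infinity] by auto
  qed
  then show ?less ?le by blast+
qed

lemma rate_nonneg:
  assumes "0 < r" "r < 1"
  shows "0 \<le> rate x r"
proof (cases "return_time x r")
  case (enat m)
  then show ?thesis
    using rate_finite[OF assms enat] return_time_attained[OF enat] assms
    by (simp add: divide_nonneg_neg divide_nonneg_pos)
qed (simp add: rate_infinite[OF assms])

section \<open>Extreme values of the rates as countable conditions\<close>

text \<open>Since \<open>P\<close> weakens as its index decreases, one index can control both the
  strength of \<open>P\<close> and the smallness of \<open>r\<close>. This leaves a single countable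
  quantifier.\<close>

lemma frequently_at_right_0_diagonal:
  assumes anti: "\<And>m n r. m \<le> n \<Longrightarrow> P n r \<Longrightarrow> P m r"
  shows "(\<forall>n. \<exists>\<^sub>F r in at_right 0. P n r) \<longleftrightarrow> (\<forall>n. \<exists>r. 0 < r \<and> r < 1 / real (Suc n) \<and> P n r)"
proof (intro iffI allI)
  fix n
  assume "\<forall>n. \<exists>\<^sub>F r in at_right 0. P n r"
  moreover have "\<forall>\<^sub>F r in at_right 0. 0 < r \<and> r < 1 / real (Suc n)"
    unfolding eventually_at_right_field by (intro exI[of _ "1 / real (Suc n)"]) simp
  ultimately show "\<exists>r. 0 < r \<and> r < 1 / real (Suc n) \<and> P n r"
    by (metis (mono_tags, lifting) frequently_eventually_frequently frequently_ex)
next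
  fix n
  assume *: "\<forall>n. \<exists>r. 0 < r \<and> r < 1 / real (Suc n) \<and> P n r"
  show "\<exists>\<^sub>F r in at_right 0. P n r"
    unfolding frequently_def eventually_at_right_field
  proof clarify
    fix b :: real
    assume b: "b > 0" "\<forall>y>0. y < b \<longrightarrow> \<not> P n y"
    obtain m where "1 / real (Suc m) < b" using nat_approx_posE[OF b(1)] by blast
    \<comment> \<open>The part \<open>m\<close> of the index forces \<open>r < b\<close>, the part
      \<open>n\<close> gives \<open>P n r\<close> by \<open>anti\<close>.\<close>
    obtain r where r: "0 < r" "r < 1 / real (Suc (max m n))" "P (max m n) r" using * by blast
    have "1 / real (Suc (max m n)) \<le> 1 / real (Suc m)" by (intro divide_left_mono) auto
    with r(2) \<open>1 / real (Suc m) < b\<close> have "r < b" by linarith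
    moreover have "P n r" using anti[OF _ r(3)] by simp
    ultimately show False using b(2) r(1) by blast
  qed
qed

lemma upper_rate_eq_infinity_iff:
  "upper_rate x = \<infinity> \<longleftrightarrow> (\<forall>n. \<exists>r. 0 < r \<and> r < 1 / real (Suc n) \<and> ereal (real n) < rate x r)"
proof -
  have "upper_rate x = \<infinity> \<longleftrightarrow> (\<forall>n. \<exists>\<^sub>F r in at_right 0. ereal (real n) < rate x r)"
  proof
    assume *: "upper_rate x = \<infinity>"
    show "\<forall>n. \<exists>\<^sub>F r in at_right 0. ereal (real n) < rate x r"
    proof (rule allI, rule ccontr)
      fix n
      assume "\<not> (\<exists>\<^sub>F r in at_right 0. ereal (real n) < rate x r)"
      then have "\<forall>\<^sub>F r in at_right 0. rate x r \<le> ereal (real n)"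
        by (simp add: not_frequently not_less)
      then have "upper_rate x \<le> ereal (real n)"
        unfolding upper_rate_def rate_def[symmetric] by (rule Limsup_bounded)
      with * show False by simp
    qed
  next
    assume *: "\<forall>n. \<exists>\<^sub>F r in at_right 0. ereal (real n) < rate x r"
    show "upper_rate x = \<infinity>"
    proof (rule ccontr)
      assume "upper_rate x \<noteq> \<infinity>"
      then obtain n where "upper_rate x < ereal (real n)"
        using less_PInf_Ex_of_nat[of "upper_rate x"] by auto
      then have "\<forall>\<^sub>F r in at_right 0. rate x r < ereal (real n)"
        unfolding upper_rate_def rate_def[symmetric] by (rule Limsup_lessD)
      then have "\<forall>\<^sub>F r in at_right 0. \<not> ereal (real n) < rate x r"
        by eventually_elim simp
      then show False using * by (auto simp: frequently_def)
    qed
  qed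
  also have "\<dots> \<longleftrightarrow> (\<forall>n. \<exists>r. 0 < r \<and> r < 1 / real (Suc n) \<and> ereal (real n) < rate x r)"
    by (rule frequently_at_right_0_diagonal) (metis ereal_less_eq(3) le_less_trans of_nat_le_iff)
  finally show ?thesis .
qed

lemma lower_rate_eq_0_iff:
  "lower_rate x = 0 \<longleftrightarrow>
    (\<forall>n. \<exists>r. 0 < r \<and> r < 1 / real (Suc n) \<and> rate x r < ereal (1 / real (Suc n)))"
proof -
  \<comment> \<open>Nonnegativity turns \<open>lower_rate x = 0\<close> into an upper bound, to be
    tested against each \<open>1 / real (Suc n)\<close>.\<close>
  have "\<forall>\<^sub>F r in at_right 0. 0 \<le> rate x r"
    unfolding eventually_at_right_field by (intro exI[of _ 1]) (simp add: rate_nonneg)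
  then have "0 \<le> lower_rate x"
    unfolding lower_rate_def rate_def[symmetric] by (rule Liminf_bounded)
  have "lower_rate x = 0 \<longleftrightarrow> (\<forall>n. \<exists>\<^sub>F r in at_right 0. rate x r < ereal (1 / real (Suc n)))"
  proof
    assume *: "lower_rate x = 0"
    show "\<forall>n. \<exists>\<^sub>F r in at_right 0. rate x r < ereal (1 / real (Suc n))"
    proof (rule allI, rule ccontr)
      fix n
      assume "\<not> (\<exists>\<^sub>F r in at_right 0. rate x r < ereal (1 / real (Suc n)))"
      then have "\<forall>\<^sub>F r in at_right 0. ereal (1 / real (Suc n)) \<le> rate x r"
        by (simp only: not_frequently not_less)
      then have "ereal (1 / real (Suc n)) \<le> lower_rate x"
        unfolding lower_rate_def rate_def[symmetric] by (rule Liminf_bounded)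
      with * have "1 / real (Suc n) \<le> 0" by (simp only: ereal_less_eq(3) zero_ereal_def)
      then show False by (simp add: divide_simps)
    qed
  next
    assume *: "\<forall>n. \<exists>\<^sub>F r in at_right 0. rate x r < ereal (1 / real (Suc n))"
    show "lower_rate x = 0"
    proof (rule ccontr)
      assume "lower_rate x \<noteq> 0"
      with \<open>0 \<le> lower_rate x\<close> have "0 < lower_rate x" by simp
      then obtain e where e: "0 < e" "ereal e < lower_rate x"
        using ereal_dense2 by (metis ereal_less(2))
      then obtain n where "1 / real (Suc n) < e" using nat_approx_posE by blast
      then have "ereal (1 / real (Suc n)) < lower_rate x"
        using e(2) by (meson less_ereal.simps(1) less_trans)
      then have "\<forall>\<^sub>F r in at_right 0. ereal (1 / real (Suc n)) < rate x r"
        unfolding lower_rate_def rate_def[symmetric] by (rule less_LiminfD)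
      then have "\<forall>\<^sub>F r in at_right 0. \<not> rate x r < ereal (1 / real (Suc n))"
        by eventually_elim simp
      then show False using * unfolding frequently_def by blast
    qed
  qed
  also have "\<dots> \<longleftrightarrow>
    (\<forall>n. \<exists>r. 0 < r \<and> r < 1 / real (Suc n) \<and> rate x r < ereal (1 / real (Suc n)))"
  proof (rule frequently_at_right_0_diagonal)
    fix m n r assume "m \<le> n" and *: "rate x r < ereal (1 / real (Suc n))"
    then have "1 / real (Suc n) \<le> 1 / real (Suc m)" by (intro divide_left_mono) auto
    with * show "rate x r < ereal (1 / real (Suc m))"
      by (meson ereal_less_eq(3) less_le_trans)
  qed
  finally show ?thesis .
qed

section \<open>The two sets are countable intersections of open sets\<close>

lemma continuous_on_funpow_full_shift:
  "continuous_on UNIV ((full_shift ^^ k) :: (int \<Rightarrow> 'a::topological_space) \<Rightarrow> _)"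
  unfolding funpow_full_shift[abs_def]
  by (intro continuous_on_coordinatewise_then_product continuous_on_product_coordinates)

text \<open>A metric is continuous for its own topology, and \<open>mtopology_shift_dist\<close>
  identifies that topology with the product topology, for which the powers of the shift are
  continuous.\<close>

lemma continuous_on_return_dist:
  "continuous_on UNIV (\<lambda>x :: int \<Rightarrow> 'a::metric_space. shift_dist x ((full_shift ^^ k) x))"
proof -
  have "continuous_map euclidean euclideanreal
      (\<lambda>x :: int \<Rightarrow> 'a. shift_dist x ((full_shift ^^ k) x))"
    using continuous_map_mdist[of euclidean fullshift.Self "\<lambda>x. x" "full_shift ^^ k"]
      continuous_on_funpow_full_shift[where 'a = 'a, of k]
    by (simp add: mtopology_of_def mtopology_shift_dist)
  then show ?thesis by simp
qed

lemma open_return_dist: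
  shows "open {x :: int \<Rightarrow> 'a::metric_space. shift_dist x ((full_shift ^^ k) x) < r}"
    and "open {x :: int \<Rightarrow> 'a. r < shift_dist x ((full_shift ^^ k) x)}"
  by (intro open_Collect_less continuous_on_return_dist continuous_on_const)+

lemma gdelta_INT_open:
  assumes "\<And>n::nat. open (U n)"
  shows "gdelta_in euclidean (\<Inter>n. U n)"
  using assms by (intro gdelta_in_Inter) (auto intro!: open_imp_gdelta_in)

text \<open>The rate exceeds \<open>c\<close> at \<open>r\<close> exactly when no \<open>k\<close>
  with \<open>1 \<le> k \<le> r powr - c\<close> is a return within \<open>r\<close>; each such
  \<open>k\<close> contributes an open condition.\<close>

lemma gdelta_upper_rate: "gdelta_in euclidean {x :: int \<Rightarrow> 'a::metric_space. upper_rate x = \<infinity>}"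
proof -
  have *: "open {x :: int \<Rightarrow> 'a. ereal c < rate x r}" if "0 < r" "r < 1" for c r
  proof -
    \<comment> \<open>Finiteness of this set keeps the intersection below open.\<close>
    let ?K = "{k. k \<ge> 1 \<and> real k \<le> r powr - c}"
    have "k \<le> nat \<lfloor>r powr - c\<rfloor>" if "k \<in> ?K" for k
      using that by (simp add: le_nat_floor)
    then have "finite ?K"
      by (meson finite_nat_set_iff_bounded_le)
    moreover have "{x :: int \<Rightarrow> 'a. ereal c < rate x r} =
        (\<Inter>k\<in>?K. {x. r < shift_dist x ((full_shift ^^ k) x)})"
      using rate_iff(2)[OF that, of _ c] by (force simp: not_le[symmetric])
    ultimately show ?thesis by (auto intro: open_INT open_return_dist)
  qed
  have "{x :: int \<Rightarrow> 'a. upper_rate x = \<infinity>} =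
      (\<Inter>n. \<Union>r\<in>{0<..<1 / real (Suc n)}. {x. ereal (real n) < rate x r})"
    by (auto simp: upper_rate_eq_infinity_iff Bex_def)
  moreover have "open (\<Union>r\<in>{0<..<1 / real (Suc n)}. {x :: int \<Rightarrow> 'a. ereal (real n) < rate x r})" for n
  proof (intro open_UN ballI *)
    fix r assume r: "r \<in> {0<..<1 / real (Suc n)}"
    have "1 / real (Suc n) \<le> 1" by simp
    with r show "0 < r" "r < 1" by (simp_all only: greaterThanLessThan_iff) linarith
  qed
  ultimately show ?thesis by (simp only: gdelta_INT_open)
qed

text \<open>A rate below \<open>c\<close> asserts that some return exists, so unions over
  \<open>r\<close> and \<open>k\<close> suffice and no finiteness enters.\<close>

lemma gdelta_lower_rate: "gdelta_in euclidean {x :: int \<Rightarrow> 'a::metric_space. lower_rate x = 0}"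
proof -
  define U where "U n = (\<Union>r\<in>{0<..<1 / real (Suc n)}.
      \<Union>k\<in>{k. k \<ge> 1 \<and> real k < r powr - (1 / real (Suc n))}.
        {x :: int \<Rightarrow> 'a. shift_dist x ((full_shift ^^ k) x) < r})" for n
  \<comment> \<open>The closed condition \<open>d(x, T\<^sup>k x) \<le> r\<close> is opened up by enlarging \<open>r\<close> slightly.\<close>
  have U: "x \<in> U n \<longleftrightarrow> (\<exists>r. 0 < r \<and> r < 1 / real (Suc n) \<and> rate x r < ereal (1 / real (Suc n)))"
    for x n
  proof -
    define c where "c = 1 / real (Suc n)"
    have c: "c \<le> 1" by (simp add: c_def)
    have "x \<in> U n \<longleftrightarrow> (\<exists>r. 0 < r \<and> r < c \<and>
        (\<exists>k\<ge>1. shift_dist x ((full_shift ^^ k) x) < r \<and> real k < r powr - c))"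
      by (auto simp: U_def c_def)
    also have "\<dots> \<longleftrightarrow> (\<exists>r. 0 < r \<and> r < c \<and>
        (\<exists>k\<ge>1. shift_dist x ((full_shift ^^ k) x) \<le> r \<and> real k < r powr - c))" (is "?L \<longleftrightarrow> ?R")
    proof
      assume ?R
      then obtain r k where r: "0 < r" "r < c" "k \<ge> 1"
        "shift_dist x ((full_shift ^^ k) x) \<le> r" "real k < r powr - c" by blast
      \<comment> \<open>The inequalities \<open>real k < r powr - c\<close> and \<open>r < c\<close>
        are strict, so both survive replacing \<open>r\<close> by a slightly larger
        \<open>s\<close>.\<close>
      have "((\<lambda>s. s powr - c) \<longlongrightarrow> r powr - c) (at_right r)"
        using r(1) by (intro tendsto_intros) auto
      then have "\<forall>\<^sub>F s in at_right r. real k < s powr - c"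
        using r(5) by (rule order_tendstoD)
      moreover have "\<forall>\<^sub>F s in at_right r. r < s \<and> s < c"
        unfolding eventually_at_right_field using r(2) by blast
      ultimately have "\<forall>\<^sub>F s in at_right r. real k < s powr - c \<and> r < s \<and> s < c"
        by (rule eventually_conj)
      then obtain s where "real k < s powr - c" "r < s" "s < c"
        using eventually_happens' trivial_limit_at_right_real by blast
      with r show ?L by (intro exI[of _ s] conjI exI[of _ k]) auto
    qed (meson less_imp_le)
    \<comment> \<open>Here \<open>c \<le> 1\<close> supplies the condition \<open>r < 1\<close> of
      \<open>rate_iff\<close>.\<close>
    also have "\<dots> \<longleftrightarrow> (\<exists>r. 0 < r \<and> r < c \<and> rate x r < ereal c)"
      using rate_iff(1)[of _ x c] c by (metis less_le_trans)
    finally show ?thesis by (simp only: c_def)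
  qed
  have "open (U n)" for n
    unfolding U_def by (intro open_UN ballI open_return_dist)
  moreover have "{x :: int \<Rightarrow> 'a. lower_rate x = 0} = (\<Inter>n. U n)"
    by (auto simp: lower_rate_eq_0_iff U simp del: of_nat_Suc)
  ultimately show ?thesis by (simp only: gdelta_INT_open)
qed

section \<open>Density\<close>

text \<open>A basic open set of the product constrains finitely many coordinates, and these lie in
  some window \<open>{- int N..int N}\<close>.\<close>

lemma dense_in_sequencesI:
  fixes S :: "(int \<Rightarrow> 'a::topological_space) set"
  assumes "\<And>z N. \<exists>x\<in>S. \<forall>i\<in>{- int N..int N}. x i = z i"
  shows "closure S = UNIV"
proof (intro set_eqI iffI UNIV_I)
  fix z
  show "z \<in> closure S"
    unfolding closure_iff_nhds_not_empty
  proof (intro allI impI)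
    fix A V :: "(int \<Rightarrow> 'a) set"
    assume V: "V \<subseteq> A" "open V" "z \<in> V"
    have "openin (product_topology (\<lambda>i. euclidean) UNIV) V"
      using V(2) by (simp add: open_fun_def)
    from product_topology_open_contains_basis[OF this V(3)]
    obtain X where X: "z \<in> Pi\<^sub>E UNIV X" "finite {i. X i \<noteq> UNIV}" "Pi\<^sub>E UNIV X \<subseteq> V"
      by (simp, blast)
    obtain N where N: "\<And>i. X i \<noteq> UNIV \<Longrightarrow> nat \<bar>i\<bar> \<le> N"
      using finite_imageI[OF X(2), of "\<lambda>i. nat \<bar>i\<bar>"] by (auto simp: finite_nat_set_iff_bounded_le)
    obtain x where x: "x \<in> S" "\<forall>i\<in>{- int N..int N}. x i = z i" using assms by blast
    have "x i \<in> X i" for i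
    proof (cases "X i = UNIV")
      case False
      then have "nat \<bar>i\<bar> \<le> N" by (rule N)
      then have "i \<in> {- int N..int N}" by (auto simp: nat_le_iff abs_le_iff)
      then have "x i = z i" using x(2) by blast
      then show ?thesis using X(1) by auto
    qed simp
    then have "x \<in> A" using X(3) V(1) by (auto simp: PiE_iff)
    then show "S \<inter> A \<noteq> {}" using x(1) by blast
  qed
qed

text \<open>For every \<open>r < \<delta>\<close> there is no return at all, so at radii below 1 the
  rate exceeds every real bound.\<close>

lemma upper_rate_nonrecurrent:
  assumes "\<delta> > 0" "\<And>k. k \<ge> 1 \<Longrightarrow> \<delta> \<le> shift_dist x ((full_shift ^^ k) x)"
  shows "upper_rate x = \<infinity>"
  unfolding upper_rate_eq_infinity_iff
proof
  fix n
  have *: "1 / real (Suc n) \<le> 1" "1 / real (Suc n) > 0" by auto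
  obtain r where r: "0 < r" "r < min \<delta> (1 / real (Suc n))"
    using dense[of 0 "min \<delta> (1 / real (Suc n))"] assms(1) *(2) by auto
  then have "r < 1" using *(1) by linarith
  have "\<not> shift_dist x ((full_shift ^^ k) x) \<le> r" if "k \<ge> 1" for k
    using assms(2)[OF that] r(2) by simp
  then have "\<not> rate x r \<le> ereal (real n)"
    unfolding rate_iff(2)[OF r(1) \<open>r < 1\<close>] by blast
  with r show "\<exists>r. 0 < r \<and> r < 1 / real (Suc n) \<and> ereal (real n) < rate x r"
    by (intro exI[of _ r]) auto
qed

text \<open>The period \<open>k\<close> is a return time for every radius, whereas
  \<open>r powr - c\<close> tends to infinity as \<open>r\<close> tends to 0.\<close>

lemma lower_rate_periodic:
  assumes "k \<ge> 1" "(full_shift ^^ k) x = x"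
  shows "lower_rate x = 0"
  unfolding lower_rate_eq_0_iff
proof
  fix n
  define c where "c = 1 / real (Suc n)"
  have c: "c > 0" "c \<le> 1" by (auto simp: c_def)
  have "\<forall>\<^sub>F r in at_right 0. real k < r powr - c"
    using c(1) by real_asymp
  moreover have "\<forall>\<^sub>F r in at_right 0. 0 < r \<and> r < c"
    unfolding eventually_at_right_field using c by blast
  ultimately have "\<forall>\<^sub>F r in at_right 0. real k < r powr - c \<and> 0 < r \<and> r < c"
    by (rule eventually_conj)
  then obtain r where r: "real k < r powr - c" "0 < r" "r < c"
    using eventually_happens' trivial_limit_at_right_real by blast
  then have "rate x r < ereal c"
    using rate_iff(1)[of r x c] c assms by auto
  with r show "\<exists>r. 0 < r \<and> r < 1 / real (Suc n) \<and> rate x r < ereal (1 / real (Suc n))"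
    unfolding c_def by blast
qed

text \<open>A finite T1 space is discrete. Infinitude provides a symbol outside any finite
  alphabet.\<close>

lemma infinite_UNIV_perfect_space: "infinite (UNIV :: 'a::{perfect_space, t1_space} set)"
proof
  assume "finite (UNIV :: 'a set)"
  then have "open {a}" for a :: 'a
    by (metis finite_imp_closed finite_subset open_closed top_greatest)
  then show False using not_open_singleton by blast
qed

lemma ratio_mono:
  fixes a b :: real
  assumes "0 \<le> a" "a \<le> b"
  shows "a / (1 + a) \<le> b / (1 + b)"
  using assms by (simp add: divide_simps algebra_simps)

lemma dense_upper_rate:
  "closure {x :: int \<Rightarrow> 'a::{metric_space, perfect_space}. upper_rate x = \<infinity>} = UNIV"
proof (rule dense_in_sequencesI)
  fix z :: "int \<Rightarrow> 'a" and N
  define F where "F = z ` {- int N..int N}"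
  have F: "finite F" "z 0 \<in> F" by (auto simp: F_def)
  obtain c where c: "c \<notin> F"
    using ex_new_if_finite[OF infinite_UNIV_perfect_space F(1)] by blast
  \<comment> \<open>The fresh symbol \<open>c\<close> stands only at \<open>int N + 1\<close>, just
    right of the window. For \<open>k \<ge> 1\<close> the shifted sequence has there the entry
    \<open>x (int N + 1 - int k)\<close>, which lies in \<open>F\<close>.\<close>
  define x where "x i = (if i \<in> {- int N..int N} then z i else if i = int N + 1 then c else z 0)" for i
  have xF: "x i \<in> F" if "i \<le> int N" for i
    using that F(2) by (auto simp: x_def F_def)
  have "open (- F)" using F(1) by (simp add: finite_imp_closed open_Compl)
  then obtain e where e: "e > 0" "ball c e \<subseteq> - F" using c open_contains_ball by blast
  have far: "e \<le> dist c y" if "y \<in> F" for y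
    using that e(2) by (meson ComplD mem_ball not_le subset_eq)
  \<comment> \<open>The least possible contribution of coordinate \<open>int N + 1\<close> to the
    distance when the two entries are at least \<open>e\<close> apart.\<close>
  define \<delta> where "\<delta> = 1 / 2 ^ nat \<bar>int N + 1\<bar> * (e / (1 + e))"
  have "\<delta> > 0" using e(1) by (simp add: \<delta>_def)
  moreover have "\<delta> \<le> shift_dist x ((full_shift ^^ k) x)" if "k \<ge> 1" for k
  proof -
    let ?a = "dist (x (int N + 1)) ((full_shift ^^ k) x (int N + 1))"
    have "e \<le> ?a"
      using far[OF xF[of "int N + 1 - int k"]] that by (simp add: funpow_full_shift x_def)
    then have "e / (1 + e) \<le> ?a / (1 + ?a)"
      using e(1) by (intro ratio_mono) auto
    then have "\<delta> \<le> 1 / 2 ^ nat \<bar>int N + 1\<bar> * (?a / (1 + ?a))"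
      unfolding \<delta>_def by (rule mult_left_mono) simp
    also have "\<dots> \<le> shift_dist x ((full_shift ^^ k) x)"
      by (rule term_le_shift_dist)
    finally show ?thesis .
  qed
  ultimately have "upper_rate x = \<infinity>" by (rule upper_rate_nonrecurrent)
  then show "\<exists>x\<in>{x. upper_rate x = \<infinity>}. \<forall>i\<in>{- int N..int N}. x i = z i"
    by (intro bexI[of _ x]) (auto simp: x_def)
qed

lemma dense_lower_rate:
  "closure {x :: int \<Rightarrow> 'a::metric_space. lower_rate x = 0} = UNIV"
proof (rule dense_in_sequencesI)
  fix z :: "int \<Rightarrow> 'a" and N
  \<comment> \<open>The block of \<open>z\<close> on the window, of length
    \<open>2 * int N + 1\<close>, is repeated periodically. Adding \<open>int N\<close> moves the
    window to \<open>{0..2 * int N}\<close>, where \<open>mod\<close> is the identity.\<close>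
  define x where "x i = z ((i + int N) mod (2 * int N + 1) - int N)" for i
  have "(full_shift ^^ (2 * N + 1)) x = x"
    unfolding funpow_full_shift
  proof
    fix i
    have "i - int (2 * N + 1) + int N = i + int N - (2 * int N + 1)" by simp
    then show "x (i - int (2 * N + 1)) = x i"
      unfolding x_def by (simp only: minus_mod_self2)
  qed
  then have "lower_rate x = 0" by (rule lower_rate_periodic[rotated]) simp
  then show "\<exists>x\<in>{x. lower_rate x = 0}. \<forall>i\<in>{- int N..int N}. x i = z i"
    by (intro bexI[of _ x]) (auto simp: x_def)
qed

section \<open>Measurability and the full-measure claim\<close>

lemma gdelta_imp_borel:
  assumes "gdelta_in euclidean S"
  shows "S \<in> sets borel"
proof -
  from assms obtain \<U> where "countable \<U>" "\<U> \<subseteq> Collect open" "S = \<Inter>\<U>"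
    by (auto simp: gdelta_in_alt intersection_of_def)
  then have "(\<Inter>U\<in>\<U>. U) \<in> sets borel"
    by (intro sets.countable_INT'') auto
  then show ?thesis using \<open>S = \<Inter>\<U>\<close> by simp
qed

theorem proposition3p4:
  "gdelta_in fullshift.mtopology {x :: int \<Rightarrow> 'a::{polish_space, perfect_space}. upper_rate x = \<infinity>}
   \<and> fullshift.mtopology closure_of {x :: int \<Rightarrow> 'a. upper_rate x = \<infinity>} = UNIV
   \<and> gdelta_in fullshift.mtopology {x :: int \<Rightarrow> 'a. lower_rate x = 0}
   \<and> fullshift.mtopology closure_of {x :: int \<Rightarrow> 'a. lower_rate x = 0} = UNIV
   \<and> (\<forall>\<mu> :: (int \<Rightarrow> 'a) measure.
        prob_space \<mu> \<and> sets \<mu> = sets borel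
        \<and> full_shift \<in> measurable \<mu> \<mu> \<and> distr \<mu> \<mu> full_shift = \<mu>
        \<and> msupport \<mu> = UNIV
        \<and> (AE x in \<mu>. upper_rate x = \<infinity>) \<and> (AE x in \<mu>. lower_rate x = 0)
        \<longrightarrow> emeasure \<mu> ({x. upper_rate x = \<infinity>} \<inter> {x. lower_rate x = 0}) = 1)"
proof -
  have "emeasure \<mu> ({x. upper_rate x = \<infinity>} \<inter> {x. lower_rate x = 0}) = 1"
    if \<mu>: "prob_space \<mu>" "sets \<mu> = sets borel"
      "AE x in \<mu>. upper_rate x = \<infinity>" "AE x in \<mu>. lower_rate x = 0"
    for \<mu> :: "(int \<Rightarrow> 'a) measure"
  proof (rule prob_space.emeasure_eq_1_AE[OF \<mu>(1)])
    \<comment> \<open>Passing from an almost-everywhere statement to measure one requires a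
      measurable set; the G-delta property supplies this.\<close>
    show "{x. upper_rate x = \<infinity>} \<inter> {x. lower_rate x = 0} \<in> sets \<mu>"
      unfolding \<mu>(2)
      by (intro sets.Int gdelta_imp_borel gdelta_upper_rate gdelta_lower_rate)
    show "AE x in \<mu>. x \<in> {x. upper_rate x = \<infinity>} \<inter> {x. lower_rate x = 0}"
      using \<mu>(3,4) by eventually_elim simp
  qed
  then show ?thesis
    \<comment> \<open>Moves the topological claims from the metric topology to the product topology
      used in the preceding lemmas.\<close>
    unfolding mtopology_shift_dist
    by (auto simp: gdelta_upper_rate gdelta_lower_rate dense_upper_rate dense_lower_rate)
qed

end
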